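(* Let $G=(V,E)$ be a finite connected loopless graph. Then: (i) For each $\beta\in F_\mathbb{Z}$, the map $d^*$ restricts to a linear projection from $\square_\beta$ onto the Voronoi cell $\mathrm{Vor}_\Delta(d^*(\beta))$, and $d^*$ maps the interior of $\square_\beta$ onto the interior of $\mathrm{Vor}_\Delta(d^*(\beta))$. (ii) For each $\beta\in F_\mathbb{Z}$, $(d^* )^{-1}(\mathrm{Vor}_\Delta(d^*(\beta)))\cap\square_{F_\mathbb{Z}}=\square_\beta$. (iii) All the fibers of $d^*\colon\square_{F_\mathbb{Z}}\to\Lambda_\mathbb{R}$ are compact and contractible; in particular $\square_{F_\mathbb{Z}}$ is contractible. (iv) The dual complexes of $\square_{F_\mathbb{Z}}$ and of the Voronoi decomposition $\{\mathrm{Vor}_\Delta(\lambda)\}_{\lambda\in\Lambda_\mathbb{Z}}$ are isomorphic.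
   Context: $\mathbb{E}$: oriented edges of $G$ ($e=uv$, tail $u$, head $v$, reverse $\bar e$). $C^0(G,A)$ = functions $V\to A$; $C^1(G,A)$ = functions $x\colon\mathbb{E}\to A$ with $x_{\bar e}=-x_e$. $d(f)(uv)=f(v)-f(u)$; $d^*\colon C^1(G,\mathbb{R})\to C^0(G,\mathbb{R})$, $d^*(x)(v)=\sum_{e\in\mathbb{E},\ \mathrm{head}(e)=v}x_e$ (the adjoint of $d$ for the inner products $\langle f,g\rangle=\sum_vf(v)g(v)$ and $\langle x,y\rangle=\sum_{e\in E}x_ey_e$, each edge counted once). $F_A=d(C^0(G,A))$, $\Lambda_A=d^*(F_A)$; $H_{0,\mathbb{R}}=\{f\in C^0(G,\mathbb{R}):\sum_vf(v)=0\}=\Lambda_\mathbb{R}$. $\Delta=d^*d$ is the Laplacian, and $q$ is the quadratic form on $H_{0,\mathbb{R}}$ given by $q(h)=\langle f,\Delta f\rangle$ for any $f$ with $\Delta f=h$. For $\lambda\in\Lambda_\mathbb{Z}$, $\mathrm{Vor}_\Delta(\lambda)=\{x\in H_{0,\mathbb{R}}:q(x-\lambda)\le q(x-\mu)\ \forall\mu\in\Lambda_\mathbb{Z}\}$. For $\beta\in C^1(G,\mathbb{Z})$, $\square_\beta=\{x\in C^1(G,\mathbb{R}):\max_{e}|x_e-\beta_e|\le\frac12\}$, and $\square_{F_\mathbb{Z}}=\bigcup_{\beta\in F_\mathbb{Z}}\square_\beta$. The dual complex of $\square_{F_\mathbb{Z}}$ is the simplicial complex with vertex set $F_\mathbb{Z}$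 whose simplices are the finite subsets $S$ with $\bigcap_{\beta\in S}\square_\beta\neq\emptyset$; that of the Voronoi decomposition has vertex set $\Lambda_\mathbb{Z}$ and simplices the finite $S$ with $\bigcap_{\lambda\in S}\mathrm{Vor}_\Delta(\lambda)\ne\emptyset$. *)

theory Defs
  imports "HOL-Analysis.Analysis" "Graph_Theory.Graph_Theory"
begin

text \<open>
  A graph (parallel edges allowed) is given by its oriented edges: \<open>arcs G\<close> is the set of
  oriented edges and the fixed-point-free involution \<open>arev\<close> of \<^locale>\<open>bidirected_digraph\<close> sends
  an oriented edge to its reverse. Vertices and oriented edges are subsets of finite types, so that
  the cochain spaces are subspaces of Euclidean spaces; cochains are extended by 0 outside
  \<open>verts G\<close> and \<open>arcs G\<close>. In particular \<open>arcs G\<close> may be empty. Cochains with values in the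
  subgroup \<open>A\<close> of the reals are obtained with \<open>A = \<int>\<close> and \<open>A = UNIV\<close>.
\<close>

definition C0 :: "('v::finite, 'e::finite) pre_digraph \<Rightarrow> real set \<Rightarrow> (real ^ 'v) set" where
  "C0 G A = {f. (\<forall>v \<in> verts G. f $ v \<in> A) \<and> (\<forall>v. v \<notin> verts G \<longrightarrow> f $ v = 0)}"

definition C1 :: "('v::finite, 'e::finite) pre_digraph \<Rightarrow> ('e \<Rightarrow> 'e) \<Rightarrow> real set \<Rightarrow> (real ^ 'e) set"
  where
  "C1 G arev A = {x. (\<forall>e \<in> arcs G. x $ e \<in> A \<and> x $ arev e = - x $ e) \<and>
                     (\<forall>e. e \<notin> arcs G \<longrightarrow> x $ e = 0)}"

definition cobd :: "('v::finite, 'e::finite) pre_digraph \<Rightarrow> real ^ 'v \<Rightarrow> real ^ 'e" where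
  "cobd G f = (\<chi> e. if e \<in> arcs G then f $ head G e - f $ tail G e else 0)"

definition cobd_adj :: "('v::finite, 'e::finite) pre_digraph \<Rightarrow> real ^ 'e \<Rightarrow> real ^ 'v" where
  "cobd_adj G x = (\<chi> v. \<Sum>e \<in> {e \<in> arcs G. head G e = v}. x $ e)"

definition Flat :: "('v::finite, 'e::finite) pre_digraph \<Rightarrow> real set \<Rightarrow> (real ^ 'e) set" where
  "Flat G A = cobd G ` C0 G A"

definition Lam :: "('v::finite, 'e::finite) pre_digraph \<Rightarrow> real set \<Rightarrow> (real ^ 'v) set" where
  "Lam G A = cobd_adj G ` Flat G A"

definition H0 :: "('v::finite, 'e::finite) pre_digraph \<Rightarrow> (real ^ 'v) set" where
  "H0 G = {f \<in> C0 G UNIV. (\<Sum>v \<in> verts G. f $ v) = 0}"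

definition lapl :: "('v::finite, 'e::finite) pre_digraph \<Rightarrow> real ^ 'v \<Rightarrow> real ^ 'v" where
  "lapl G f = cobd_adj G (cobd G f)"

text \<open>The value does not depend on the choice of \<open>f\<close>; see \<open>qform_lapl\<close> below.\<close>

definition qform :: "('v::finite, 'e::finite) pre_digraph \<Rightarrow> real ^ 'v \<Rightarrow> real" where
  "qform G h = (THE r. \<exists>f \<in> C0 G UNIV. lapl G f = h \<and> r = f \<bullet> lapl G f)"

definition Vor :: "('v::finite, 'e::finite) pre_digraph \<Rightarrow> real ^ 'v \<Rightarrow> (real ^ 'v) set" where
  "Vor G l = {x \<in> H0 G. \<forall>m \<in> Lam G \<int>. qform G (x - l) \<le> qform G (x - m)}"

definition cube :: "('v::finite, 'e::finite) pre_digraph \<Rightarrow> ('e \<Rightarrow> 'e) \<Rightarrow> real ^ 'e \<Rightarrow> (real ^ 'e) set"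
  where
  "cube G arev b = {x \<in> C1 G arev UNIV. \<forall>e \<in> arcs G. \<bar>x $ e - b $ e\<bar> \<le> 1 / 2}"

definition cubes :: "('v::finite, 'e::finite) pre_digraph \<Rightarrow> ('e \<Rightarrow> 'e) \<Rightarrow> (real ^ 'e) set" where
  "cubes G arev = (\<Union>b \<in> Flat G \<int>. cube G arev b)"

text \<open>An abstract simplicial complex is given by its vertex set and its set of simplices.\<close>

definition dual_complex :: "'i set \<Rightarrow> ('i \<Rightarrow> 'a set) \<Rightarrow> 'i set set" where
  "dual_complex I cell = {S. finite S \<and> S \<subseteq> I \<and> (\<Inter>i \<in> S. cell i) \<noteq> {}}"

definition complex_isomorphic :: "'i set \<Rightarrow> 'i set set \<Rightarrow> 'j set \<Rightarrow> 'j set set \<Rightarrow> bool" where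
  "complex_isomorphic V K W L \<longleftrightarrow>
     (\<exists>\<phi>. bij_betw \<phi> V W \<and> (\<forall>S. S \<subseteq> V \<longrightarrow> (S \<in> K \<longleftrightarrow> \<phi> ` S \<in> L)))"

lemma linear_cobd: "linear (cobd G)"
  by (rule linearI) (auto simp: cobd_def vec_eq_iff algebra_simps)

lemma linear_cobd_adj: "linear (cobd_adj G)"
  by (rule linearI) (auto simp: cobd_adj_def vec_eq_iff sum.distrib sum_distrib_left)

lemma linear_lapl: "linear (lapl G)"
  using linear_compose[OF linear_cobd linear_cobd_adj] by (simp add: lapl_def[abs_def] o_def)

lemma subspace_C0: "subspace (C0 G UNIV)"
  by (auto simp: subspace_def C0_def)

lemma subspace_H0: "subspace (H0 G)"
  by (auto simp: subspace_def H0_def C0_def sum.distrib simp flip: sum_distrib_left)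

text \<open>
  The right-hand side is the inner product on 1-cochains that counts each edge once: the sum over
  oriented edges counts it twice.
\<close>

lemma cobd_adjoint:
  fixes G :: "('v::finite, 'e::finite) pre_digraph"
  assumes "bidirected_digraph G arev" and x: "x \<in> C1 G arev UNIV"
  shows "f \<bullet> cobd_adj G x = (\<Sum>e \<in> arcs G. cobd G f $ e * x $ e) / 2"
proof -
  interpret bidirected_digraph G arev by fact
  have "f \<bullet> cobd_adj G x = (\<Sum>v \<in> UNIV. \<Sum>e \<in> {e \<in> arcs G. head G e = v}. f $ head G e * x $ e)"
    by (auto simp: inner_vec_def cobd_adj_def sum_distrib_left intro!: sum.cong)
  also have "\<dots> = (\<Sum>e \<in> arcs G. f $ head G e * x $ e)"
    by (rule sum.group) auto
  finally have 1: "f \<bullet> cobd_adj G x = (\<Sum>e \<in> arcs G. f $ head G e * x $ e)" .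
  also have "\<dots> = (\<Sum>e \<in> arcs G. f $ head G (arev e) * x $ arev e)"
    using sum.permute[OF arev_permutes_arcs, of "\<lambda>e. f $ head G e * x $ e"] by (simp add: o_def)
  also have "\<dots> = - (\<Sum>e \<in> arcs G. f $ tail G e * x $ e)"
    using x by (auto simp: C1_def sum_negf[symmetric] intro!: sum.cong)
  finally have 2: "f \<bullet> cobd_adj G x = - (\<Sum>e \<in> arcs G. f $ tail G e * x $ e)" .
  have "(\<Sum>e \<in> arcs G. cobd G f $ e * x $ e) =
      (\<Sum>e \<in> arcs G. f $ head G e * x $ e) - (\<Sum>e \<in> arcs G. f $ tail G e * x $ e)"
    by (auto simp: cobd_def sum_subtractf[symmetric] algebra_simps intro!: sum.cong)
  with 1 2 show ?thesis by simp
qed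

lemma cobd_in_C1:
  assumes "bidirected_digraph G arev"
  shows "cobd G f \<in> C1 G arev UNIV"
proof -
  interpret bidirected_digraph G arev by fact
  show ?thesis by (auto simp: C1_def cobd_def)
qed

lemma inner_lapl:
  assumes "bidirected_digraph G arev"
  shows "f \<bullet> lapl G g = (\<Sum>e \<in> arcs G. cobd G f $ e * cobd G g $ e) / 2"
  unfolding lapl_def by (rule cobd_adjoint[OF assms cobd_in_C1[OF assms]])

lemma qform_lapl:
  assumes "bidirected_digraph G arev" and "f \<in> C0 G UNIV"
  shows "qform G (lapl G f) = f \<bullet> lapl G f"
  unfolding qform_def
proof (rule the_equality)
  show "\<exists>f'\<in>C0 G UNIV. lapl G f' = lapl G f \<and> f \<bullet> lapl G f = f' \<bullet> lapl G f'"
    using assms by blast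
next
  fix r assume "\<exists>g\<in>C0 G UNIV. lapl G g = lapl G f \<and> r = g \<bullet> lapl G g"
  then obtain g where g: "lapl G g = lapl G f" "r = g \<bullet> lapl G g" by blast
  have "g \<bullet> lapl G f = f \<bullet> lapl G g"
    unfolding inner_lapl[OF assms(1)] by (simp add: mult.commute)
  with g show "r = f \<bullet> lapl G f" by simp
qed

lemma H0_eq_Lam:
  fixes G :: "('v::finite, 'e::finite) pre_digraph"
  assumes "bidirected_digraph G arev" and con: "Digraph_Component.connected G"
  shows "H0 G = Lam G UNIV"
proof -
  interpret bidirected_digraph G arev by fact
  have lam: "Lam G UNIV = lapl G ` C0 G UNIV"
    by (simp add: Lam_def Flat_def image_image lapl_def)
  have sub: "lapl G f \<in> H0 G" for f
  proof -
    have "(\<chi> v. 1) \<bullet> lapl G f = 0"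
      unfolding inner_lapl[OF assms(1)] by (simp add: cobd_def)
    moreover have C: "lapl G f \<in> C0 G UNIV"
      by (auto simp: C0_def lapl_def cobd_adj_def intro!: sum.neutral)
    moreover have "(\<Sum>v \<in> verts G. lapl G f $ v) = (\<Sum>v \<in> UNIV. lapl G f $ v)"
      using C by (intro sum.mono_neutral_left) (auto simp: C0_def)
    ultimately show ?thesis by (simp add: H0_def inner_vec_def)
  qed
  have zero: "f = 0" if f: "f \<in> H0 G" and l: "lapl G f = 0" for f
  proof -
    have "(\<Sum>e \<in> arcs G. cobd G f $ e * cobd G f $ e) = 0"
      using inner_lapl[OF assms(1), of f f] l by simp
    then have "\<forall>e \<in> arcs G. cobd G f $ e * cobd G f $ e = 0"
      by (subst (asm) sum_nonneg_eq_0_iff) auto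
    then have arc: "f $ head G e = f $ tail G e" if "e \<in> arcs G" for e
      using that by (simp add: cobd_def)
    have const: "f $ u = f $ v" if "u \<in> verts G" "v \<in> verts G" for u v
    proof -
      have "(u, v) \<in> rtrancl_on (verts G) ((arcs_ends G)\<^sup>s)"
        using con that unfolding connected_conv by blast
      then show ?thesis
      proof (induction rule: rtrancl_on_induct)
        case (step v w)
        from step.hyps obtain e where "e \<in> arcs G"
          "(v = tail G e \<and> w = head G e) \<or> (v = head G e \<and> w = tail G e)"
          by (auto simp: arcs_ends_conv symcl_def)
        then show ?case using arc[of e] step.IH by auto
      qed simp
    qed
    obtain u where u: "u \<in> verts G" using con unfolding connected_conv by blast
    have "(\<Sum>v \<in> verts G. f $ v) = real (card (verts G)) * f $ u"
      using sum.cong[OF refl const[OF _ u], of "verts G"] by simp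
    with f u have "f $ u = 0" by (auto simp: H0_def)
    have "f $ v = 0" for v
    proof (cases "v \<in> verts G")
      case True
      then show ?thesis using const[OF True u] \<open>f $ u = 0\<close> by simp
    next
      case False
      then show ?thesis using f by (simp add: H0_def C0_def)
    qed
    then show "f = 0" by (simp add: vec_eq_iff)
  qed
  have inj: "inj_on (lapl G) (H0 G)"
    using linear_injective_on_subspace_0[OF linear_lapl subspace_H0] zero by blast
  have "lapl G ` H0 G = H0 G"
  proof (rule subspace_dim_equal)
    show "subspace (lapl G ` H0 G)" by (rule linear_subspace_image[OF linear_lapl subspace_H0])
    have "dim (lapl G ` H0 G) = dim (H0 G)"
      using inj by (intro dim_image_eq[OF linear_lapl]) (simp add: span_eq_iff[THEN iffD2, OF subspace_H0])
    then show "dim (H0 G) \<le> dim (lapl G ` H0 G)" by simp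
  qed (use sub subspace_H0 in auto)
  moreover have "H0 G \<subseteq> C0 G UNIV" by (auto simp: H0_def)
  ultimately show ?thesis unfolding lam using sub by blast
qed

end

theory Submission
  imports Defs
begin

text \<open>
  On \<open>F\<^sub>\<real>\<close> the map \<open>d\<^sup>*\<close> is injective and \<open>q (d\<^sup>* x) = |x|\<^sup>2 / 2\<close>. Since \<open>\<langle>\<gamma>, x\<rangle>\<close> for
  \<open>\<gamma> \<in> F\<^sub>\<int>\<close> depends on a cochain \<open>x\<close> only through \<open>d\<^sup>* x\<close>, it follows that \<open>d\<^sup>* x\<close> lies in the Voronoi
  cell of \<open>d\<^sup>* \<beta>\<close> iff \<open>2 \<langle>\<gamma>, x - \<beta>\<rangle> \<le> |\<gamma>|\<^sup>2\<close> for all \<open>\<gamma> \<in> F\<^sub>\<int>\<close>. For \<open>x\<close> in the cube of \<open>\<beta>\<close>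
  this holds edge by edge because \<open>|n| \<le> n\<^sup>2\<close> for integers \<open>n\<close>; the equality case of the same
  estimate shows that a point of a cube that is mapped into another Voronoi cell lies in the
  corresponding cube. Conversely, a point of the cell outside the image of the cube is separated
  from it by a function \<open>f\<close>, and decomposing \<open>f\<close> into indicators of its level sets produces a cut
  that violates the Voronoi inequality.

  A fiber over a point of a Voronoi cell is therefore a slice of a single cube, hence compact and
  convex. A linear map is open from a polytope onto its image, because the image is locally a cone;
  so the element of least norm of the fiber depends continuously on the base point. This gives a
  continuous section, and the cubes retract linearly along the fibers onto it.
\<close>

section \<open>Linear images of polytopes\<close>

lemma halfspace_locally_conic:
  fixes a x :: "'a::real_inner"
  assumes "a \<bullet> x \<le> b" and t_pos: "0 < t"
  shows "eventually (\<lambda>y. a \<bullet> y \<le> b \<longrightarrow> a \<bullet> (x + (y - x) /\<^sub>R t) \<le> b) (nhds x)"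
proof (cases "a \<bullet> x = b")
  case True
  have "a \<bullet> (x + (y - x) /\<^sub>R t) \<le> b" if "a \<bullet> y \<le> b" for y
  proof -
    have "a \<bullet> (x + (y - x) /\<^sub>R t) = b + (a \<bullet> y - b) / t"
      using True by (simp add: inner_add_right inner_diff_right divide_inverse mult.commute)
    also have "\<dots> \<le> b" using that t_pos by (simp add: divide_nonpos_pos)
    finally show ?thesis .
  qed
  then show ?thesis by simp
next
  case False
  have "((\<lambda>y. a \<bullet> (x + (y - x) /\<^sub>R t)) \<longlongrightarrow> a \<bullet> (x + (x - x) /\<^sub>R t)) (nhds x)"
    by (intro tendsto_intros filterlim_ident)
  then have "eventually (\<lambda>y. a \<bullet> (x + (y - x) /\<^sub>R t) < b) (nhds x)"
    using False assms(1) by (intro order_tendstoD) auto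
  then show ?thesis by eventually_elim simp
qed

lemma polyhedron_locally_conic:
  fixes Q :: "'a::euclidean_space set"
  assumes polyhedron_Q: "polyhedron Q" and x_in_Q: "x \<in> Q" and t_pos: "0 < t"
  shows "eventually (\<lambda>y. y \<in> Q \<longrightarrow> x + (y - x) /\<^sub>R t \<in> Q) (nhds x)"
proof -
  obtain F where finite_F: "finite F" and Q_eq: "Q = \<Inter>F"
    and halfspace: "\<And>H. H \<in> F \<Longrightarrow> \<exists>a b. a \<noteq> 0 \<and> H = {x. a \<bullet> x \<le> b}"
    using polyhedron_Q unfolding polyhedron_def by metis
  have "eventually (\<lambda>y. y \<in> H \<longrightarrow> x + (y - x) /\<^sub>R t \<in> H) (nhds x)" if "H \<in> F" for H
  proof -
    obtain a b where "H = {x. a \<bullet> x \<le> b}" using halfspace[OF \<open>H \<in> F\<close>] by blast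
    then show ?thesis using halfspace_locally_conic[of a x b t] x_in_Q t_pos Q_eq \<open>H \<in> F\<close> by auto
  qed
  then have "eventually (\<lambda>y. \<forall>H\<in>F. y \<in> H \<longrightarrow> x + (y - x) /\<^sub>R t \<in> H) (nhds x)"
    using finite_F by (simp add: eventually_ball_finite)
  then show ?thesis by eventually_elim (auto simp: Q_eq)
qed

lemma openin_absorbs_contraction:
  fixes S :: "'a::real_normed_vector set"
  assumes "bounded S" and "convex S" and openin_U: "openin (top_of_set S) U" and x_in_U: "x \<in> U"
  obtains t where "0 < t" and "t \<le> 1" and "\<And>y. y \<in> S \<Longrightarrow> (1 - t) *\<^sub>R x + t *\<^sub>R y \<in> U"
proof -
  obtain e where e_pos: "0 < e" and ball_subset_U: "ball x e \<inter> S \<subseteq> U" and "U \<subseteq> S"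
    using openin_U x_in_U unfolding openin_contains_ball by blast
  obtain K where "\<And>y. y \<in> S \<Longrightarrow> dist x y \<le> K"
    using \<open>bounded S\<close> unfolding bounded_any_center[of S x] by blast
  then obtain M where M_pos: "0 < M" and dist_le_M: "\<And>y. y \<in> S \<Longrightarrow> dist x y \<le> M"
    by (rule_tac that[of "max 1 K"]) (auto simp: le_max_iff_disj)
  define t where "t = min 1 (e / (2 * M))"
  have t_pos: "0 < t" and t_le_1: "t \<le> 1" using e_pos M_pos by (auto simp: t_def)
  have "(1 - t) *\<^sub>R x + t *\<^sub>R y \<in> U" if y_in_S: "y \<in> S" for y
  proof -
    have "(1 - t) *\<^sub>R x + t *\<^sub>R y \<in> S"
      using \<open>convex S\<close> x_in_U \<open>U \<subseteq> S\<close> y_in_S t_pos t_le_1 by (intro convexD_alt) auto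
    moreover have "dist x ((1 - t) *\<^sub>R x + t *\<^sub>R y) < e"
    proof -
      have "dist x ((1 - t) *\<^sub>R x + t *\<^sub>R y) = t * dist x y"
        using t_pos t_le_1 by (simp add: dist_norm algebra_simps flip: scaleR_diff_right)
      also have "\<dots> \<le> e / (2 * M) * M"
        using M_pos dist_le_M t_pos t_le_1 by (intro mult_mono) (auto simp: t_def y_in_S)
      also have "\<dots> < e" using M_pos e_pos by simp
      finally show ?thesis .
    qed
    ultimately show ?thesis using ball_subset_U by auto
  qed
  with t_pos t_le_1 show thesis by (rule that)
qed

text \<open>The image is a polytope, hence locally a cone: a point near \<open>f x\<close> in the image is the endpoint
  of a short initial part of a segment from \<open>f x\<close> within the image, and such a segment lifts.\<close>

lemma openin_linear_image_polytope:
  fixes f :: "'a::euclidean_space \<Rightarrow> 'b::euclidean_space"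
  assumes linear_f: "linear f" and polytope_P: "polytope P" and openin_U: "openin (top_of_set P) U"
  shows "openin (top_of_set (f ` P)) (f ` U)"
  unfolding openin_contains_ball
proof (intro conjI ballI)
  show "f ` U \<subseteq> f ` P" using openin_imp_subset[OF openin_U] by blast
next
  fix z assume "z \<in> f ` U"
  then obtain x where x_in_U: "x \<in> U" and z_eq: "z = f x" by blast
  obtain t where t_pos: "0 < t" and contraction_in_U: "\<And>y. y \<in> P \<Longrightarrow> (1 - t) *\<^sub>R x + t *\<^sub>R y \<in> U"
    using openin_absorbs_contraction[OF polytope_imp_bounded[OF polytope_P]
        polytope_imp_convex[OF polytope_P] openin_U x_in_U]
    by blast
  have "polyhedron (f ` P)"
    using linear_f polytope_P by (simp add: polytope_imp_polyhedron polytope_linear_image)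
  moreover have "z \<in> f ` P" using x_in_U z_eq openin_imp_subset[OF openin_U] by blast
  ultimately have "eventually (\<lambda>z'. z' \<in> f ` P \<longrightarrow> z + (z' - z) /\<^sub>R t \<in> f ` P) (nhds z)"
    using t_pos by (rule polyhedron_locally_conic)
  then obtain d where d_pos: "0 < d"
    and conic: "\<And>z'. dist z' z < d \<Longrightarrow> z' \<in> f ` P \<Longrightarrow> z + (z' - z) /\<^sub>R t \<in> f ` P"
    unfolding eventually_nhds_metric by blast
  have "z' \<in> f ` U" if "z' \<in> ball z d \<inter> f ` P" for z'
  proof -
    have "z + (z' - z) /\<^sub>R t \<in> f ` P" using conic[of z'] that by (simp add: dist_commute)
    then obtain y where y_in_P: "y \<in> P" and f_y: "f y = z + (z' - z) /\<^sub>R t" by (metis imageE)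
    have "f ((1 - t) *\<^sub>R x + t *\<^sub>R y) = (1 - t) *\<^sub>R z + t *\<^sub>R (z + (z' - z) /\<^sub>R t)"
      by (simp only: linear_add[OF linear_f] linear_scale[OF linear_f] f_y z_eq)
    also have "\<dots> = z'" using t_pos by (simp add: algebra_simps)
    finally show ?thesis using contraction_in_U[OF y_in_P] by blast
  qed
  then show "\<exists>d>0. ball z d \<inter> f ` P \<subseteq> f ` U" using d_pos by blast
qed

lemma linear_image_interior_of_affine_hull:
  fixes f :: "'a::euclidean_space \<Rightarrow> 'b::euclidean_space"
  assumes linear_f: "linear f" and convex_S: "convex S"
  shows "f ` (top_of_set (affine hull S) interior_of S) =
    top_of_set (f ` (affine hull S)) interior_of (f ` S)"
proof -
  have interior_of_eq_rel_interior: "top_of_set (affine hull T) interior_of T = rel_interior T"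
    for T :: "'c::euclidean_space set"
    unfolding interior_of_def rel_interior_def by blast
  have "f ` (affine hull S) = affine hull (f ` S)"
    using affine_hull_linear_image linear_f by (metis linear_conv_bounded_linear)
  then show ?thesis
    using rel_interior_convex_linear_image[OF linear_f convex_S]
    by (simp add: interior_of_eq_rel_interior)
qed

section \<open>Fibers and sections\<close>

abbreviation fiber :: "('a \<Rightarrow> 'b) \<Rightarrow> 'a set \<Rightarrow> 'b \<Rightarrow> 'a set" where
  "fiber f S y \<equiv> {x \<in> S. f x = y}"

lemma convex_fiber_linear:
  assumes "linear f" and "convex S"
  shows "convex (fiber f S y)"
  using convex_Int[OF assms(2) convex_linear_vimage[OF assms(1) convex_singleton[of y]]]
  by (simp add: Int_def)

lemma compact_fiber:
  fixes f :: "'a::t2_space \<Rightarrow> 'b::t1_space"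
  assumes "compact S" and "continuous_on S f"
  shows "compact (fiber f S y)"
proof -
  have "closedin (top_of_set S) (S \<inter> f -` {y})"
    using assms(2) by (rule continuous_closedin_preimage) simp
  moreover have "S \<inter> f -` {y} = fiber f S y" by auto
  ultimately show ?thesis using closedin_compact[OF assms(1)] by simp
qed

lemma closedin_fiberwise_minimizers:
  fixes f :: "'a::topological_space \<Rightarrow> 'b::topological_space"
    and g :: "'a \<Rightarrow> 'c::{dense_linorder, linorder_topology}"
  assumes continuous_f: "continuous_on S f" and continuous_g: "continuous_on S g"
    and open_map: "\<And>U. openin (top_of_set S) U \<Longrightarrow> openin (top_of_set (f ` S)) (f ` U)"
  shows "closedin (top_of_set S) {x \<in> S. \<forall>x'\<in>S. f x' = f x \<longrightarrow> g x \<le> g x'}" (is "closedin _ ?M")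
proof -
  have "S - ?M = (\<Union>r. (S \<inter> f -` (f ` (S \<inter> g -` {..<r}))) \<inter> (S \<inter> g -` {r<..}))" (is "_ = ?W")
  proof
    show "S - ?M \<subseteq> ?W"
    proof
      fix x assume "x \<in> S - ?M"
      then obtain x' where x_in_S: "x \<in> S" and x'_in_S: "x' \<in> S" and same_fiber: "f x' = f x"
        and smaller: "g x' < g x"
        by force
      obtain r where "g x' < r" "r < g x" using dense[OF smaller] by blast
      then show "x \<in> ?W"
        using x_in_S x'_in_S same_fiber smaller by (auto intro!: exI[of _ r] image_eqI[of _ f x'])
    qed
    show "?W \<subseteq> S - ?M" by force
  qed
  moreover have "openin (top_of_set S) ?W"
  proof (intro openin_Union ballI, elim imageE, hypsubst)
    fix r
    have "openin (top_of_set (f ` S)) (f ` (S \<inter> g -` {..<r}))"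
      using continuous_openin_preimage_gen[OF continuous_g open_lessThan] by (rule open_map)
    then have "openin (top_of_set S) (S \<inter> f -` (f ` (S \<inter> g -` {..<r})))"
      using continuous_f continuous_on_open by blast
    then show "openin (top_of_set S)
        ((S \<inter> f -` (f ` (S \<inter> g -` {..<r}))) \<inter> (S \<inter> g -` {r<..}))"
      using continuous_openin_preimage_gen[OF continuous_g open_greaterThan] by (rule openin_Int)
  qed
  ultimately show ?thesis by (simp add: closedin_def)
qed

text \<open>The points closest to \<open>a\<close> in their fibers form a compact set on which \<open>f\<close> is injective, and
  the section is the inverse of \<open>f\<close> on this set.\<close>

lemma continuous_on_closest_point_fiber:
  fixes f :: "'a::euclidean_space \<Rightarrow> 'b::t2_space"
  assumes compact_S: "compact S" and continuous_f: "continuous_on S f"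
    and open_map: "\<And>U. openin (top_of_set S) U \<Longrightarrow> openin (top_of_set (f ` S)) (f ` U)"
    and convex_fiber: "\<And>y. convex (fiber f S y)"
  shows "continuous_on (f ` S) (\<lambda>y. closest_point (fiber f S y) a)"
proof -
  define s where "s y = closest_point (fiber f S y) a" for y
  define M where "M = {x \<in> S. \<forall>x'\<in>S. f x' = f x \<longrightarrow> dist a x \<le> dist a x'}"
  have closed_fiber: "closed (fiber f S y)" for y
    by (rule compact_imp_closed[OF compact_fiber[OF compact_S continuous_f]])
  have "closedin (top_of_set S) M"
    unfolding M_def by (intro closedin_fiberwise_minimizers continuous_f open_map continuous_intros)
  then have "compact M" by (rule closedin_compact[OF compact_S])
  moreover have "M \<subseteq> S" by (auto simp: M_def)
  moreover have "s (f x) = x" if "x \<in> M" for x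
    unfolding s_def using that closest_point_unique[OF convex_fiber closed_fiber, of x "f x" a]
    by (simp add: M_def)
  ultimately have "continuous_on (f ` M) s"
    using continuous_on_subset[OF continuous_f] by (intro continuous_on_inv) auto
  moreover have "f ` S \<subseteq> f ` M"
  proof
    fix y assume "y \<in> f ` S"
    then have "s y \<in> fiber f S y"
      unfolding s_def by (intro closest_point_in_set closed_fiber) auto
    moreover have "dist a (s y) \<le> dist a x" if "x \<in> fiber f S y" for x
      unfolding s_def using closed_fiber that by (rule closest_point_le)
    ultimately have "s y \<in> M" and "y = f (s y)" by (simp_all add: M_def)
    then show "y \<in> f ` M" by blast
  qed
  ultimately show ?thesis unfolding s_def by (rule continuous_on_subset)
qed

lemma continuous_on_locally_finite_closed_cover:
  assumes closed: "\<And>i. i \<in> I \<Longrightarrow> closedin (top_of_set S) (T i)"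
    and cover: "S \<subseteq> (\<Union>i\<in>I. T i)"
    and locally_finite:
      "\<And>x. x \<in> S \<Longrightarrow> \<exists>V. openin (top_of_set S) V \<and> x \<in> V \<and> finite {i \<in> I. T i \<inter> V \<noteq> {}}"
    and continuous: "\<And>i. i \<in> I \<Longrightarrow> continuous_on (T i) f"
  shows "continuous_on S f"
proof -
  have "continuous_map (top_of_set S) euclidean f"
  proof (rule pasting_lemma_locally_finite[where I = I and T = T and f = "\<lambda>_. f"])
    show "continuous_map (subtopology (top_of_set S) (T i)) euclidean f" if "i \<in> I" for i
      using continuous[OF that] closedin_imp_subset[OF closed[OF that]]
      by (simp add: subtopology_subtopology inf.absorb2)
  qed (use closed cover locally_finite in auto)
  then show ?thesis by simp
qed

lemma homotopy_eqv_convex_fibers_section: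
  fixes X :: "'a::real_normed_vector set" and f :: "'a \<Rightarrow> 'b::real_normed_vector"
  assumes continuous_f: "continuous_on X f" and image_f: "f ` X \<subseteq> Y"
    and continuous_s: "continuous_on Y s" and image_s: "s ` Y \<subseteq> X"
    and inverse: "\<And>y. y \<in> Y \<Longrightarrow> f (s y) = y" and convex_fiber: "\<And>y. y \<in> Y \<Longrightarrow> convex (fiber f X y)"
  shows "X homotopy_eqv Y"
proof -
  have "homotopic_with_canon (\<lambda>_. True) X X (s \<circ> f) id"
  proof (rule homotopic_with_linear)
    show "continuous_on X (s \<circ> f)"
      using continuous_on_compose2[OF continuous_s continuous_f image_f] by (simp add: o_def)
    fix x assume x_in_X: "x \<in> X"
    have "closed_segment (s (f x)) x \<subseteq> fiber f X (f x)"
      using x_in_X image_f image_s inverse by (intro closed_segment_subset convex_fiber) auto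
    then show "closed_segment ((s \<circ> f) x) (id x) \<subseteq> X" by auto
  qed (rule continuous_on_id')
  moreover have "homotopic_with_canon (\<lambda>_. True) Y Y (f \<circ> s) id"
    using continuous_on_compose2[OF continuous_f continuous_s image_s] image_f image_s inverse
    by (intro homotopic_with_equal) (auto simp: o_def)
  ultimately show ?thesis
    unfolding homotopy_equivalent_space_def using continuous_f image_f continuous_s image_s
    by (intro exI[of _ f] exI[of _ s]) auto
qed

section \<open>Isomorphisms of dual complexes\<close>

lemma Inter_cells_nonempty_iff:
  assumes vimage: "\<And>i. i \<in> I \<Longrightarrow> f -` D i \<inter> (\<Union>i\<in>I. C i) = C i"
    and onto: "\<And>i. i \<in> I \<Longrightarrow> D i \<subseteq> f ` (\<Union>i\<in>I. C i)" and "S \<subseteq> I"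
  shows "(\<Inter>i\<in>S. C i) \<noteq> {} \<longleftrightarrow> (\<Inter>i\<in>S. D i) \<noteq> {}"
proof (cases "S = {}")
  case False
  then obtain i where i_in_S: "i \<in> S" by blast
  have mem_iff: "x \<in> C j \<longleftrightarrow> f x \<in> D j" if "j \<in> S" "x \<in> (\<Union>i\<in>I. C i)" for j x
    using vimage[of j] that \<open>S \<subseteq> I\<close> by blast
  show ?thesis
  proof
    assume "(\<Inter>i\<in>S. C i) \<noteq> {}"
    then obtain x where "\<And>j. j \<in> S \<Longrightarrow> x \<in> C j" by blast
    then have "f x \<in> D j" if "j \<in> S" for j using mem_iff[OF that] \<open>S \<subseteq> I\<close> that by blast
    then show "(\<Inter>i\<in>S. D i) \<noteq> {}" by blast
  next
    assume "(\<Inter>i\<in>S. D i) \<noteq> {}"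
    then obtain y where y_in_D: "\<And>j. j \<in> S \<Longrightarrow> y \<in> D j" by blast
    then have "y \<in> f ` (\<Union>i\<in>I. C i)" using onto[of i] \<open>S \<subseteq> I\<close> i_in_S by blast
    then obtain x where x_in_Union: "x \<in> (\<Union>i\<in>I. C i)" and "y = f x" by blast
    then have "x \<in> C j" if "j \<in> S" for j using mem_iff[OF that x_in_Union] y_in_D[OF that] by simp
    then show "(\<Inter>i\<in>S. C i) \<noteq> {}" by blast
  qed
qed simp

lemma complex_isomorphic_dual_complex:
  assumes bij_\<phi>: "bij_betw \<phi> I J"
    and vimage: "\<And>i. i \<in> I \<Longrightarrow> f -` D (\<phi> i) \<inter> (\<Union>i\<in>I. C i) = C i"
    and onto: "\<And>i. i \<in> I \<Longrightarrow> D (\<phi> i) \<subseteq> f ` (\<Union>i\<in>I. C i)"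
  shows "complex_isomorphic I (dual_complex I C) J (dual_complex J D)"
proof -
  have "S \<in> dual_complex I C \<longleftrightarrow> \<phi> ` S \<in> dual_complex J D" if S_subset: "S \<subseteq> I" for S
  proof -
    have "(\<Inter>i\<in>S. C i) \<noteq> {} \<longleftrightarrow> (\<Inter>i\<in>S. D (\<phi> i)) \<noteq> {}"
      using vimage onto S_subset by (rule Inter_cells_nonempty_iff)
    moreover have "finite (\<phi> ` S) \<longleftrightarrow> finite S"
      using finite_image_iff inj_on_subset[OF bij_betw_imp_inj_on[OF bij_\<phi>] S_subset] by blast
    moreover have "\<phi> ` S \<subseteq> J" using S_subset bij_betw_imp_surj_on[OF bij_\<phi>] by blast
    ultimately show ?thesis using S_subset by (simp add: dual_complex_def)
  qed
  with bij_\<phi> show ?thesis unfolding complex_isomorphic_def by blast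
qed

section \<open>Integral vectors\<close>

lemma closest_subgroup_point_iff:
  fixes x \<beta> :: "'a::real_inner"
  assumes \<beta>_in: "\<beta> \<in> \<Lambda>" and plus: "\<And>\<gamma> \<delta>. \<gamma> \<in> \<Lambda> \<Longrightarrow> \<delta> \<in> \<Lambda> \<Longrightarrow> \<gamma> + \<delta> \<in> \<Lambda>"
    and minus: "\<And>\<gamma> \<delta>. \<gamma> \<in> \<Lambda> \<Longrightarrow> \<delta> \<in> \<Lambda> \<Longrightarrow> \<gamma> - \<delta> \<in> \<Lambda>"
  shows "(\<forall>\<gamma>\<in>\<Lambda>. norm (x - \<beta>) \<le> norm (x - \<gamma>)) \<longleftrightarrow> (\<forall>\<gamma>\<in>\<Lambda>. 2 * (\<gamma> \<bullet> (x - \<beta>)) \<le> \<gamma> \<bullet> \<gamma>)"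
proof -
  have translate: "norm (x - \<beta>) \<le> norm (x - (\<beta> + \<gamma>)) \<longleftrightarrow> 2 * (\<gamma> \<bullet> (x - \<beta>)) \<le> \<gamma> \<bullet> \<gamma>" for \<gamma>
  proof -
    have "norm (x - (\<beta> + \<gamma>)) = norm ((x - \<beta>) - \<gamma>)" by (simp add: algebra_simps)
    then show ?thesis
      by (simp add: norm_le inner_diff_left[of "x - \<beta>" \<gamma>] inner_diff_right[of _ "x - \<beta>" \<gamma>]
          inner_commute[of "x - \<beta>" \<gamma>] del: inner_diff_left inner_diff_right)
  qed
  have "(\<forall>\<gamma>\<in>\<Lambda>. norm (x - \<beta>) \<le> norm (x - \<gamma>)) \<longleftrightarrow> (\<forall>\<gamma>\<in>\<Lambda>. norm (x - \<beta>) \<le> norm (x - (\<beta> + \<gamma>)))"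
    using plus[OF \<beta>_in] minus[OF _ \<beta>_in]
    by (metis add_diff_cancel_left' diff_add_cancel add.commute)
  then show ?thesis by (simp only: translate)
qed

lemma two_mult_le_square_Ints:
  fixes a z :: real
  assumes "a \<in> \<int>" and abs_z_le: "\<bar>z\<bar> \<le> 1 / 2"
  shows "2 * (a * z) \<le> a * a"
proof (cases "a = 0")
  case False
  then have "1 \<le> \<bar>a\<bar>" using Ints_nonzero_abs_ge1[OF assms(1)] by simp
  then have "2 * \<bar>z\<bar> \<le> \<bar>a\<bar>" using abs_z_le by simp
  then have "\<bar>a\<bar> * (2 * \<bar>z\<bar>) \<le> \<bar>a\<bar> * \<bar>a\<bar>" by (intro mult_left_mono) auto
  moreover have "a * z \<le> \<bar>a\<bar> * \<bar>z\<bar>" by (simp flip: abs_mult)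
  ultimately show ?thesis by simp
qed simp

lemma two_inner_le_inner_self_Ints:
  fixes a z :: "real ^ 'n"
  assumes "\<And>i. a $ i \<in> \<int>" and "\<And>i. \<bar>z $ i\<bar> \<le> 1 / 2"
  shows "2 * (a \<bullet> z) \<le> a \<bullet> a"
  using assms
  by (auto simp: inner_vec_def sum_distrib_left intro!: sum_mono two_mult_le_square_Ints)

lemma abs_diff_le_half_of_two_inner_ge:
  fixes a z :: "real ^ 'n"
  assumes a_Ints: "\<And>i. a $ i \<in> \<int>" and abs_z_le: "\<And>i. \<bar>z $ i\<bar> \<le> 1 / 2"
    and two_inner_ge: "a \<bullet> a \<le> 2 * (a \<bullet> z)"
  shows "\<bar>z $ i - a $ i\<bar> \<le> 1 / 2"
proof -
  have nonneg: "0 \<le> a $ j * a $ j - 2 * (a $ j * z $ j)" for j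
    using two_mult_le_square_Ints[OF a_Ints abs_z_le] by simp
  have "(\<Sum>j\<in>UNIV. a $ j * a $ j - 2 * (a $ j * z $ j)) = a \<bullet> a - 2 * (a \<bullet> z)"
    by (simp add: inner_vec_def sum_subtractf sum_distrib_left)
  also have "\<dots> = 0" using two_inner_ge two_inner_le_inner_self_Ints[OF a_Ints abs_z_le] by simp
  finally have "a $ i * a $ i - 2 * (a $ i * z $ i) = 0"
    using nonneg by (simp add: sum_nonneg_eq_0_iff)
  then have "a $ i * (a $ i - 2 * z $ i) = 0" by (simp add: algebra_simps)
  then have "a $ i = 0 \<or> a $ i = 2 * z $ i" by simp
  then show ?thesis using abs_z_le[of i] by auto
qed

section \<open>Integral cochains and cubes\<close>

lemma C0_Ints_nth: "f \<in> C0 G \<int> \<Longrightarrow> f $ v \<in> \<int>"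
  by (cases "v \<in> verts G") (auto simp: C0_def)

lemma Flat_Ints_nth: "x \<in> Flat G \<int> \<Longrightarrow> x $ e \<in> \<int>"
  by (auto simp: Flat_def cobd_def C0_Ints_nth)

lemma Flat_mono: "A \<subseteq> B \<Longrightarrow> Flat G A \<subseteq> Flat G B"
  by (auto simp: Flat_def C0_def)

lemma zero_in_Flat_Ints: "0 \<in> Flat G \<int>"
  unfolding Flat_def by (rule image_eqI[of _ _ 0]) (auto simp: C0_def linear_0[OF linear_cobd])

lemma Flat_Ints_add: "x \<in> Flat G \<int> \<Longrightarrow> y \<in> Flat G \<int> \<Longrightarrow> x + y \<in> Flat G \<int>"
  unfolding Flat_def by (auto simp: C0_def simp flip: linear_add[OF linear_cobd])

lemma Flat_Ints_diff: "x \<in> Flat G \<int> \<Longrightarrow> y \<in> Flat G \<int> \<Longrightarrow> x - y \<in> Flat G \<int>"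
  unfolding Flat_def by (auto simp: C0_def simp flip: linear_diff[OF linear_cobd])

lemma Flat_Ints_dist_less_1:
  assumes "x \<in> Flat G \<int>" "y \<in> Flat G \<int>" "dist x y < 1"
  shows "x = y"
proof -
  have "x $ e = y $ e" for e
  proof -
    have "\<bar>x $ e - y $ e\<bar> < 1"
      using component_le_norm_cart[of "x - y" e] assms(3) by (simp add: dist_norm)
    moreover have "x $ e - y $ e \<in> \<int>" using assms by (simp add: Flat_Ints_nth)
    ultimately show ?thesis using Ints_nonzero_abs_less1 by fastforce
  qed
  then show ?thesis by (simp add: vec_eq_iff)
qed

lemma subspace_Flat: "subspace (Flat G UNIV)"
  unfolding Flat_def by (rule linear_subspace_image[OF linear_cobd subspace_C0])

lemma subspace_C1: "subspace (C1 G arev UNIV)"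
  by (auto simp: subspace_def C1_def)

lemma cobd_adj_diff: "cobd_adj G (x - y) = cobd_adj G x - cobd_adj G y"
  by (rule linear_diff[OF linear_cobd_adj])

lemma continuous_on_cobd_adj: "continuous_on S (cobd_adj G)"
  using linear_cobd_adj[of G] by (simp add: linear_continuous_on linear_conv_bounded_linear)

lemma cube_subset_C1: "cube G arev \<beta> \<subseteq> C1 G arev UNIV"
  by (auto simp: cube_def)

lemma cube_iff:
  assumes "\<beta> \<in> C1 G arev UNIV"
  shows "x \<in> cube G arev \<beta> \<longleftrightarrow> x \<in> C1 G arev UNIV \<and> (\<forall>e. \<bar>x $ e - \<beta> $ e\<bar> \<le> 1 / 2)"
proof -
  have "\<bar>x $ e - \<beta> $ e\<bar> \<le> 1 / 2" if "x \<in> C1 G arev UNIV" "e \<notin> arcs G" for e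
    using that assms by (simp add: C1_def)
  then show ?thesis unfolding cube_def by blast
qed

lemma cube_eq_translate_cube_zero:
  assumes \<beta>_C1: "\<beta> \<in> C1 G arev UNIV"
  shows "cube G arev \<beta> = (+) \<beta> ` cube G arev 0"
proof
  show "cube G arev \<beta> \<subseteq> (+) \<beta> ` cube G arev 0"
  proof
    fix x assume "x \<in> cube G arev \<beta>"
    then have "x - \<beta> \<in> cube G arev 0"
      using subspace_diff[OF subspace_C1 _ \<beta>_C1, of x] by (auto simp: cube_def)
    then show "x \<in> (+) \<beta> ` cube G arev 0" by (rule rev_image_eqI) simp
  qed
  show "(+) \<beta> ` cube G arev 0 \<subseteq> cube G arev \<beta>"
    using subspace_add[OF subspace_C1 \<beta>_C1] by (auto simp: cube_def)
qed

lemma polytope_cube: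
  assumes "\<beta> \<in> C1 G arev UNIV"
  shows "polytope (cube G arev \<beta>)"
proof -
  have "cube G arev \<beta> = cbox (\<beta> - (\<chi> e. 1 / 2)) (\<beta> + (\<chi> e. 1 / 2)) \<inter> C1 G arev UNIV"
    by (auto simp only: cube_iff[OF assms] mem_box_cart Int_iff abs_diff_le_iff
        vector_minus_component vector_add_component vec_lambda_beta)
  then show ?thesis
    by (simp add: polytope_Int_polyhedron polytope_interval affine_imp_polyhedron
        subspace_imp_affine subspace_C1)
qed

lemma affine_hull_cube:
  assumes \<beta>_C1: "\<beta> \<in> C1 G arev UNIV"
  shows "affine hull (cube G arev \<beta>) = C1 G arev UNIV"
proof
  have affine_hull_C1: "affine hull (C1 G arev UNIV) = C1 G arev UNIV"
    by (simp add: hull_same subspace_imp_affine subspace_C1)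
  show "affine hull (cube G arev \<beta>) \<subseteq> C1 G arev UNIV"
    using hull_mono[OF cube_subset_C1] affine_hull_C1 by blast
  have "affine hull (C1 G arev UNIV \<inter> ball \<beta> (1 / 2)) = affine hull (C1 G arev UNIV)"
    by (rule affine_hull_openin) (use \<beta>_C1 in \<open>auto simp: affine_hull_C1 openin_open\<close>)
  moreover have "C1 G arev UNIV \<inter> ball \<beta> (1 / 2) \<subseteq> cube G arev \<beta>"
  proof
    fix x assume x_in_ball: "x \<in> C1 G arev UNIV \<inter> ball \<beta> (1 / 2)"
    have "\<bar>x $ e - \<beta> $ e\<bar> \<le> 1 / 2" for e
      using component_le_norm_cart[of "x - \<beta>" e] x_in_ball
      by (simp add: dist_norm norm_minus_commute)
    then show "x \<in> cube G arev \<beta>" using x_in_ball cube_iff[OF \<beta>_C1] by blast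
  qed
  ultimately show "C1 G arev UNIV \<subseteq> affine hull (cube G arev \<beta>)"
    using hull_mono affine_hull_C1 by metis
qed

locale finite_bidirected_digraph = bidirected_digraph G arev
  for G :: "('v::finite, 'e::finite) pre_digraph" and arev :: "'e \<Rightarrow> 'e"
begin

lemma cobd_constant_on_verts:
  assumes "($) f constant_on verts G"
  shows "cobd G f = 0"
  using assms head_in_verts tail_in_verts by (auto simp: cobd_def constant_on_def vec_eq_iff)

lemma Flat_subset_C1: "Flat G A \<subseteq> C1 G arev UNIV"
  unfolding Flat_def using cobd_in_C1[OF bidirected_digraph_axioms] by blast

lemma Flat_Ints_in_C1: "\<beta> \<in> Flat G \<int> \<Longrightarrow> \<beta> \<in> C1 G arev UNIV"
  using Flat_subset_C1 by blast

lemma inner_cobd_adj: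
  assumes "x \<in> C1 G arev UNIV"
  shows "f \<bullet> cobd_adj G x = (cobd G f \<bullet> x) / 2"
proof -
  have "cobd G f \<bullet> x = (\<Sum>e \<in> arcs G. cobd G f $ e * x $ e)"
    unfolding inner_vec_def inner_real_def
    by (rule sum.mono_neutral_right) (auto simp: cobd_def)
  then show ?thesis
    using cobd_adjoint[OF bidirected_digraph_axioms assms] by simp
qed

lemma cobd_adj_in_H0:
  assumes x_C1: "x \<in> C1 G arev UNIV"
  shows "cobd_adj G x \<in> H0 G"
proof -
  have in_C0: "cobd_adj G x \<in> C0 G UNIV"
    by (auto simp: C0_def cobd_adj_def intro!: sum.neutral)
  have "(\<Sum>v \<in> verts G. cobd_adj G x $ v) = (\<Sum>v \<in> UNIV. cobd_adj G x $ v)"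
    using in_C0 by (intro sum.mono_neutral_left) (auto simp: C0_def)
  also have "\<dots> = (\<chi> v. 1) \<bullet> cobd_adj G x" by (simp add: inner_vec_def)
  also have "\<dots> = (cobd G (\<chi> v. 1) \<bullet> x) / 2" by (rule inner_cobd_adj[OF x_C1])
  also have "\<dots> = 0" by (simp add: cobd_constant_on_verts constant_on_def)
  finally show ?thesis using in_C0 by (simp add: H0_def)
qed

lemma inner_Flat_cong:
  assumes "\<gamma> \<in> Flat G A" and "x \<in> C1 G arev UNIV" and "y \<in> C1 G arev UNIV"
    and "cobd_adj G x = cobd_adj G y"
  shows "\<gamma> \<bullet> x = \<gamma> \<bullet> y"
proof -
  obtain f where "\<gamma> = cobd G f" using assms(1) by (auto simp: Flat_def)
  then show ?thesis using inner_cobd_adj[of x f] inner_cobd_adj[of y f] assms(2-4) by simp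
qed

lemma inj_on_cobd_adj_Flat: "inj_on (cobd_adj G) (Flat G UNIV)"
proof (rule linear_injective_on_subspace_0[OF linear_cobd_adj subspace_Flat, THEN iffD2], safe)
  fix x assume x_Flat: "x \<in> Flat G UNIV" and cobd_adj_x: "cobd_adj G x = 0"
  have "x \<bullet> x = x \<bullet> 0"
    using x_Flat cobd_adj_x Flat_subset_C1 subspace_0[OF subspace_C1] linear_0[OF linear_cobd_adj]
    by (intro inner_Flat_cong[OF x_Flat]) auto
  then show "x = 0" by simp
qed

lemma qform_cobd_adj:
  assumes "x \<in> Flat G UNIV"
  shows "qform G (cobd_adj G x) = (norm x)\<^sup>2 / 2"
proof -
  obtain f where f_C0: "f \<in> C0 G UNIV" and x_eq: "x = cobd G f" using assms by (auto simp: Flat_def)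
  have "qform G (cobd_adj G x) = f \<bullet> cobd_adj G x"
    using qform_lapl[OF bidirected_digraph_axioms f_C0] by (simp add: x_eq lapl_def)
  also have "\<dots> = (x \<bullet> x) / 2"
    using inner_cobd_adj[of x f] assms Flat_subset_C1 by (auto simp: x_eq)
  finally show ?thesis by (simp add: power2_norm_eq_inner)
qed

end

section \<open>Total variation\<close>

lemma peel_top_level_set:
  fixes f :: "'a \<Rightarrow> 'b::linordered_idom"
  assumes finite_V: "finite V" and not_constant: "\<not> f constant_on V"
  obtains A c where "A \<subseteq> V" and "0 < c"
    and "card ((\<lambda>v. f v - c * indicator A v) ` V) < card (f ` V)"
    and "\<And>u v. u \<in> V \<Longrightarrow> v \<in> V \<Longrightarrow> \<bar>f u - f v\<bar> =
      \<bar>(f u - c * indicator A u) - (f v - c * indicator A v)\<bar> + c * \<bar>indicator A u - indicator A v\<bar>"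
proof -
  define a where "a = Max (f ` V)"
  define b where "b = Max (f ` V - {a})"
  define A where "A = {v \<in> V. f v = a}"
  have "V \<noteq> {}" using not_constant unfolding constant_on_def by blast
  then have a_in_image: "a \<in> f ` V" unfolding a_def using finite_V by (intro Max_in) auto
  have "f ` V - {a} \<noteq> {}" using not_constant unfolding constant_on_def by blast
  then have "b \<in> f ` V - {a}" unfolding b_def using finite_V by (intro Max_in) auto
  then have b_in_image: "b \<in> f ` V - {a}" and b_less_a: "b < a"
    using finite_V by (auto simp: a_def less_le)
  have f_le_b: "f v \<le> b" if "v \<in> V" "v \<notin> A" for v
    unfolding b_def using that finite_V by (intro Max_ge) (auto simp: A_def)
  let ?g = "\<lambda>v. f v - (a - b) * indicator A v"
  have peeled_eq: "?g v = (if v \<in> A then b else f v)" for v by (auto simp: A_def)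
  have "?g v \<in> f ` V - {a}" if "v \<in> V" for v
    unfolding peeled_eq using b_in_image that by (auto simp: A_def)
  then have "?g ` V \<subseteq> f ` V - {a}" by (rule image_subsetI)
  then have "card (?g ` V) \<le> card (f ` V - {a})" using finite_V by (intro card_mono) auto
  also have "\<dots> < card (f ` V)" using finite_V a_in_image by (intro card_Diff1_less) auto
  finally have card_less: "card (?g ` V) < card (f ` V)" .
  have "\<bar>f u - f v\<bar> = \<bar>?g u - ?g v\<bar> + (a - b) * \<bar>indicator A u - indicator A v\<bar>"
    if "u \<in> V" "v \<in> V" for u v
    unfolding peeled_eq
    using f_le_b[OF that(1)] f_le_b[OF that(2)] b_less_a by (auto simp: A_def indicator_def)
  with card_less show thesis using b_less_a by (intro that[of A "a - b"]) (auto simp: A_def)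
qed

definition total_variation :: "('v::finite, 'e::finite) pre_digraph \<Rightarrow> real ^ 'v \<Rightarrow> real" where
  "total_variation G f = (\<Sum>e\<in>UNIV. \<bar>cobd G f $ e\<bar>)"

definition vertex_indicator :: "'v set \<Rightarrow> real ^ 'v" where
  "vertex_indicator A = (\<chi> v. indicator A v)"

lemma total_variation_vertex_indicator:
  "total_variation G (vertex_indicator A) =
    cobd G (vertex_indicator A) \<bullet> cobd G (vertex_indicator A)"
  by (auto simp: total_variation_def inner_vec_def cobd_def vertex_indicator_def indicator_def
      intro!: sum.cong)

lemma vertex_indicator_in_C0_Ints: "A \<subseteq> verts G \<Longrightarrow> vertex_indicator A \<in> C0 G \<int>"
  by (auto simp: C0_def vertex_indicator_def indicator_def)

context finite_bidirected_digraph
begin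

lemma total_variation_peel:
  assumes "\<not> ($) f constant_on verts G"
  obtains A c where "A \<subseteq> verts G" and "0 < c"
    and "card (($) (f - c *\<^sub>R vertex_indicator A) ` verts G) < card (($) f ` verts G)"
    and "total_variation G f =
      total_variation G (f - c *\<^sub>R vertex_indicator A) + c * total_variation G (vertex_indicator A)"
proof -
  obtain A c where A_subset: "A \<subseteq> verts G" and c_pos: "0 < c"
    and card_less: "card ((\<lambda>v. f $ v - c * indicator A v) ` verts G) < card (($) f ` verts G)"
    and abs_diff_split: "\<And>u v. u \<in> verts G \<Longrightarrow> v \<in> verts G \<Longrightarrow> \<bar>f $ u - f $ v\<bar> =
      \<bar>(f $ u - c * indicator A u) - (f $ v - c * indicator A v)\<bar> +
      c * \<bar>indicator A u - indicator A v\<bar>"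
    using peel_top_level_set[OF finite assms] by blast
  let ?g = "f - c *\<^sub>R vertex_indicator A"
  have "\<bar>cobd G f $ e\<bar> = \<bar>cobd G ?g $ e\<bar> + c * \<bar>cobd G (vertex_indicator A) $ e\<bar>" for e
    using abs_diff_split[OF head_in_verts tail_in_verts, of e e]
    by (simp add: cobd_def vertex_indicator_def)
  then have "total_variation G f =
      total_variation G ?g + c * total_variation G (vertex_indicator A)"
    by (simp add: total_variation_def sum.distrib sum_distrib_left)
  with A_subset c_pos card_less show thesis
    by (intro that[of A c]) (simp_all add: vertex_indicator_def)
qed

lemma two_inner_cobd_le_total_variation:
  assumes cut: "\<And>A. A \<subseteq> verts G \<Longrightarrow>
    2 * (cobd G (vertex_indicator A) \<bullet> x) \<le> total_variation G (vertex_indicator A)"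
  shows "2 * (cobd G f \<bullet> x) \<le> total_variation G f"
proof (induction "card (($) f ` verts G)" arbitrary: f rule: less_induct)
  case less
  show ?case
  proof (cases "($) f constant_on verts G")
    case True
    then show ?thesis by (simp add: total_variation_def cobd_constant_on_verts)
  next
    case False
    then obtain A c where A_subset: "A \<subseteq> verts G" and c_pos: "0 < c"
      and card_less: "card (($) (f - c *\<^sub>R vertex_indicator A) ` verts G) < card (($) f ` verts G)"
      and peel: "total_variation G f = total_variation G (f - c *\<^sub>R vertex_indicator A) +
        c * total_variation G (vertex_indicator A)"
      by (rule total_variation_peel)
    have "2 * (cobd G f \<bullet> x) = 2 * (cobd G (f - c *\<^sub>R vertex_indicator A) \<bullet> x) +
        c * (2 * (cobd G (vertex_indicator A) \<bullet> x))"
      by (simp add: linear_diff[OF linear_cobd] linear_scale[OF linear_cobd] algebra_simps)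
    also have "\<dots> \<le> total_variation G f"
      unfolding peel using c_pos by (intro add_mono mult_left_mono less card_less cut A_subset) simp
    finally show ?thesis .
  qed
qed

lemma total_variation_attained_on_cube:
  obtains z where "z \<in> cube G arev 0" and "2 * (cobd G f \<bullet> z) = total_variation G f"
proof
  define z :: "real ^ 'e" where "z = (\<chi> e. sgn (cobd G f $ e) / 2)"
  have "z \<in> C1 G arev UNIV"
    using cobd_in_C1[OF bidirected_digraph_axioms, of f] by (auto simp: z_def C1_def sgn_minus)
  then show "z \<in> cube G arev 0"
    unfolding cube_iff[OF subspace_0[OF subspace_C1]] by (auto simp: z_def abs_sgn_eq)
  show "2 * (cobd G f \<bullet> z) = total_variation G f"
    by (simp add: total_variation_def inner_vec_def z_def abs_sgn sum_distrib_left)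
qed

lemma cobd_adj_in_image_cube_zero:
  assumes x_C1: "x \<in> C1 G arev UNIV" and voronoi: "\<And>\<gamma>. \<gamma> \<in> Flat G \<int> \<Longrightarrow> 2 * (\<gamma> \<bullet> x) \<le> \<gamma> \<bullet> \<gamma>"
  shows "cobd_adj G x \<in> cobd_adj G ` cube G arev 0"
proof (rule ccontr)
  have polytope_image: "polytope (cobd_adj G ` cube G arev 0)"
    by (rule polytope_linear_image[OF linear_cobd_adj polytope_cube[OF subspace_0[OF subspace_C1]]])
  assume "cobd_adj G x \<notin> cobd_adj G ` cube G arev 0"
  then obtain a b where x_below: "a \<bullet> cobd_adj G x < b"
    and cube_above: "\<And>z. z \<in> cube G arev 0 \<Longrightarrow> b < a \<bullet> cobd_adj G z"
    using separating_hyperplane_closed_point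
      [OF polytope_imp_convex[OF polytope_image] polytope_imp_closed[OF polytope_image]]
    by blast
  obtain z where z_in_cube: "z \<in> cube G arev 0"
    and attains: "2 * (cobd G (- a) \<bullet> z) = total_variation G (- a)"
    by (rule total_variation_attained_on_cube)
  have z_C1: "z \<in> C1 G arev UNIV" using z_in_cube cube_subset_C1 by blast
  have "cobd G a \<bullet> x < cobd G a \<bullet> z"
    using less_trans[OF x_below cube_above[OF z_in_cube]]
    by (simp add: inner_cobd_adj[OF x_C1] inner_cobd_adj[OF z_C1])
  then have "total_variation G (- a) < 2 * (cobd G (- a) \<bullet> x)"
    unfolding attains[symmetric] by (simp add: linear_neg[OF linear_cobd])
  moreover have "2 * (cobd G (- a) \<bullet> x) \<le> total_variation G (- a)"
  proof (rule two_inner_cobd_le_total_variation)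
    fix A assume "A \<subseteq> verts G"
    then show "2 * (cobd G (vertex_indicator A) \<bullet> x) \<le> total_variation G (vertex_indicator A)"
      unfolding total_variation_vertex_indicator
      by (intro voronoi) (auto simp: Flat_def vertex_indicator_in_C0_Ints)
  qed
  ultimately show False by simp
qed

end

section \<open>Voronoi cells\<close>

locale connected_bidirected_digraph = finite_bidirected_digraph +
  assumes connected_graph: "Digraph_Component.connected G"
begin

lemma cobd_adj_image_Flat: "cobd_adj G ` Flat G UNIV = H0 G"
  using H0_eq_Lam[OF bidirected_digraph_axioms connected_graph] by (simp add: Lam_def)

lemma cobd_adj_image_C1: "cobd_adj G ` C1 G arev UNIV = H0 G"
proof
  show "H0 G \<subseteq> cobd_adj G ` C1 G arev UNIV"
    using Flat_subset_C1 cobd_adj_image_Flat by blast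
qed (use cobd_adj_in_H0 in blast)

lemma cobd_adj_Flat_mem_Vor_iff:
  assumes x_Flat: "x \<in> Flat G UNIV" and \<beta>_Flat: "\<beta> \<in> Flat G \<int>"
  shows "cobd_adj G x \<in> Vor G (cobd_adj G \<beta>) \<longleftrightarrow> (\<forall>\<gamma>\<in>Flat G \<int>. norm (x - \<beta>) \<le> norm (x - \<gamma>))"
proof -
  have qform_diff: "qform G (cobd_adj G x - cobd_adj G \<gamma>) = (norm (x - \<gamma>))\<^sup>2 / 2"
    if "\<gamma> \<in> Flat G \<int>" for \<gamma>
    using qform_cobd_adj[of "x - \<gamma>"] subspace_diff[OF subspace_Flat x_Flat]
      Flat_mono[of \<int> UNIV] that
    by (auto simp: cobd_adj_diff)
  have "cobd_adj G x \<in> H0 G" using x_Flat cobd_adj_image_Flat by blast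
  then show ?thesis using \<beta>_Flat by (simp add: Vor_def Lam_def qform_diff)
qed

lemma cobd_adj_mem_Vor_iff:
  assumes x_C1: "x \<in> C1 G arev UNIV" and \<beta>_Flat: "\<beta> \<in> Flat G \<int>"
  shows "cobd_adj G x \<in> Vor G (cobd_adj G \<beta>) \<longleftrightarrow> (\<forall>\<gamma>\<in>Flat G \<int>. 2 * (\<gamma> \<bullet> (x - \<beta>)) \<le> \<gamma> \<bullet> \<gamma>)"
proof -
  obtain y where y_Flat: "y \<in> Flat G UNIV" and cobd_adj_x: "cobd_adj G x = cobd_adj G y"
    using x_C1 cobd_adj_image_C1 cobd_adj_image_Flat by (metis imageE imageI)
  have "\<gamma> \<bullet> x = \<gamma> \<bullet> y" if "\<gamma> \<in> Flat G \<int>" for \<gamma>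
    using inner_Flat_cong[OF that x_C1 _ cobd_adj_x] y_Flat Flat_subset_C1 by blast
  then have "(\<forall>\<gamma>\<in>Flat G \<int>. 2 * (\<gamma> \<bullet> (x - \<beta>)) \<le> \<gamma> \<bullet> \<gamma>) \<longleftrightarrow>
      (\<forall>\<gamma>\<in>Flat G \<int>. 2 * (\<gamma> \<bullet> (y - \<beta>)) \<le> \<gamma> \<bullet> \<gamma>)"
    by (simp add: inner_diff_right)
  also have "\<dots> \<longleftrightarrow> (\<forall>\<gamma>\<in>Flat G \<int>. norm (y - \<beta>) \<le> norm (y - \<gamma>))"
    using closest_subgroup_point_iff[OF \<beta>_Flat Flat_Ints_add Flat_Ints_diff] by simp
  finally show ?thesis by (simp add: cobd_adj_x cobd_adj_Flat_mem_Vor_iff[OF y_Flat \<beta>_Flat])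
qed

lemma H0_eq_Union_Vor: "H0 G = (\<Union>\<beta>\<in>Flat G \<int>. Vor G (cobd_adj G \<beta>))"
proof
  show "H0 G \<subseteq> (\<Union>\<beta>\<in>Flat G \<int>. Vor G (cobd_adj G \<beta>))"
  proof
    fix h assume "h \<in> H0 G"
    then obtain x where x_Flat: "x \<in> Flat G UNIV" and h_eq: "h = cobd_adj G x"
      using cobd_adj_image_Flat by blast
    have "closed (Flat G \<int>)"
      by (rule discrete_imp_closed[of 1]) (use Flat_Ints_dist_less_1 in auto)
    then obtain \<beta> where "\<beta> \<in> Flat G \<int>" "\<And>\<gamma>. \<gamma> \<in> Flat G \<int> \<Longrightarrow> dist x \<beta> \<le> dist x \<gamma>"
      using distance_attains_inf[of "Flat G \<int>" x] zero_in_Flat_Ints by blast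
    then show "h \<in> (\<Union>\<beta>\<in>Flat G \<int>. Vor G (cobd_adj G \<beta>))"
      using cobd_adj_Flat_mem_Vor_iff[OF x_Flat] by (auto simp: h_eq dist_norm)
  qed
qed (auto simp: Vor_def)

lemma cobd_adj_cube_subset_Vor:
  assumes \<beta>_Flat: "\<beta> \<in> Flat G \<int>"
  shows "cobd_adj G ` cube G arev \<beta> \<subseteq> Vor G (cobd_adj G \<beta>)"
proof
  fix h assume "h \<in> cobd_adj G ` cube G arev \<beta>"
  then obtain x where x_in_cube: "x \<in> cube G arev \<beta>" and h_eq: "h = cobd_adj G x" by blast
  then have "\<bar>(x - \<beta>) $ e\<bar> \<le> 1 / 2" for e using cube_iff[OF Flat_Ints_in_C1[OF \<beta>_Flat]] by simp
  then have "2 * (\<gamma> \<bullet> (x - \<beta>)) \<le> \<gamma> \<bullet> \<gamma>" if "\<gamma> \<in> Flat G \<int>" for \<gamma>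
    using Flat_Ints_nth[OF that] by (intro two_inner_le_inner_self_Ints)
  then show "h \<in> Vor G (cobd_adj G \<beta>)"
    using cobd_adj_mem_Vor_iff[OF _ \<beta>_Flat] x_in_cube h_eq cube_subset_C1 by blast
qed

theorem cobd_adj_image_cube:
  assumes \<beta>_Flat: "\<beta> \<in> Flat G \<int>"
  shows "cobd_adj G ` cube G arev \<beta> = Vor G (cobd_adj G \<beta>)"
proof
  show "Vor G (cobd_adj G \<beta>) \<subseteq> cobd_adj G ` cube G arev \<beta>"
  proof
    fix h assume h_in_Vor: "h \<in> Vor G (cobd_adj G \<beta>)"
    then have "h \<in> H0 G" by (simp add: Vor_def)
    then obtain x where x_C1: "x \<in> C1 G arev UNIV" and h_eq: "h = cobd_adj G x"
      using cobd_adj_image_C1 by blast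
    have "2 * (\<gamma> \<bullet> (x - \<beta>)) \<le> \<gamma> \<bullet> \<gamma>" if "\<gamma> \<in> Flat G \<int>" for \<gamma>
      using h_in_Vor cobd_adj_mem_Vor_iff[OF x_C1 \<beta>_Flat] that by (simp add: h_eq)
    then have "cobd_adj G (x - \<beta>) \<in> cobd_adj G ` cube G arev 0"
      using subspace_diff[OF subspace_C1 x_C1] Flat_Ints_in_C1[OF \<beta>_Flat]
      by (intro cobd_adj_in_image_cube_zero)
    then obtain z where z_in_cube: "z \<in> cube G arev 0"
      and cobd_adj_z: "cobd_adj G (x - \<beta>) = cobd_adj G z"
      by blast
    have "\<beta> + z \<in> cube G arev \<beta>"
      using z_in_cube cube_eq_translate_cube_zero[OF Flat_Ints_in_C1[OF \<beta>_Flat]] by blast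
    moreover have "h = cobd_adj G (\<beta> + z)"
      using cobd_adj_z
      by (simp add: h_eq linear_add[OF linear_cobd_adj] cobd_adj_diff algebra_simps)
    ultimately show "h \<in> cobd_adj G ` cube G arev \<beta>" by blast
  qed
qed (rule cobd_adj_cube_subset_Vor[OF \<beta>_Flat])

theorem cobd_adj_image_interior_cube:
  assumes \<beta>_Flat: "\<beta> \<in> Flat G \<int>"
  shows "cobd_adj G ` (top_of_set (C1 G arev UNIV) interior_of cube G arev \<beta>) =
    top_of_set (H0 G) interior_of Vor G (cobd_adj G \<beta>)"
  using linear_image_interior_of_affine_hull
      [OF linear_cobd_adj polytope_imp_convex[OF polytope_cube]]
    Flat_Ints_in_C1[OF \<beta>_Flat]
  by (metis affine_hull_cube cobd_adj_image_C1 cobd_adj_image_cube[OF \<beta>_Flat])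

theorem vimage_Vor_Int_cubes:
  assumes \<beta>_Flat: "\<beta> \<in> Flat G \<int>"
  shows "cobd_adj G -` Vor G (cobd_adj G \<beta>) \<inter> cubes G arev = cube G arev \<beta>"
proof
  show "cube G arev \<beta> \<subseteq> cobd_adj G -` Vor G (cobd_adj G \<beta>) \<inter> cubes G arev"
    using \<beta>_Flat cobd_adj_cube_subset_Vor[OF \<beta>_Flat] by (auto simp: cubes_def)
  show "cobd_adj G -` Vor G (cobd_adj G \<beta>) \<inter> cubes G arev \<subseteq> cube G arev \<beta>"
  proof
    fix x assume x_in: "x \<in> cobd_adj G -` Vor G (cobd_adj G \<beta>) \<inter> cubes G arev"
    then obtain \<alpha> where \<alpha>_Flat: "\<alpha> \<in> Flat G \<int>" and "x \<in> cube G arev \<alpha>"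
      by (auto simp: cubes_def)
    then have x_C1: "x \<in> C1 G arev UNIV" and abs_diff_le: "\<And>e. \<bar>(x - \<alpha>) $ e\<bar> \<le> 1 / 2"
      using cube_iff[OF Flat_Ints_in_C1[OF \<alpha>_Flat]] by auto
    have "2 * ((\<alpha> - \<beta>) \<bullet> (x - \<beta>)) \<le> (\<alpha> - \<beta>) \<bullet> (\<alpha> - \<beta>)"
      using x_in cobd_adj_mem_Vor_iff[OF x_C1 \<beta>_Flat] Flat_Ints_diff[OF \<alpha>_Flat \<beta>_Flat] by blast
    then have "(\<beta> - \<alpha>) \<bullet> (\<beta> - \<alpha>) \<le> 2 * ((\<beta> - \<alpha>) \<bullet> (x - \<alpha>))"
      by (simp add: inner_diff_left inner_diff_right inner_commute algebra_simps)
    then have "\<bar>(x - \<alpha>) $ e - (\<beta> - \<alpha>) $ e\<bar> \<le> 1 / 2" for e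
      using Flat_Ints_nth[OF Flat_Ints_diff[OF \<beta>_Flat \<alpha>_Flat]] abs_diff_le
      by (intro abs_diff_le_half_of_two_inner_ge)
    then show "x \<in> cube G arev \<beta>"
      using x_C1 by (simp add: cube_iff[OF Flat_Ints_in_C1[OF \<beta>_Flat]])
  qed
qed

section \<open>Fibers of the cube complex\<close>

lemma fiber_cubes_eq_fiber_cube:
  assumes "\<beta> \<in> Flat G \<int>" and "h \<in> Vor G (cobd_adj G \<beta>)"
  shows "fiber (cobd_adj G) (cubes G arev) h = fiber (cobd_adj G) (cube G arev \<beta>) h"
  using vimage_Vor_Int_cubes[OF assms(1)] assms(2) by auto

theorem fiber_cubes_nonempty_compact_convex:
  assumes "h \<in> H0 G"
  shows "fiber (cobd_adj G) (cubes G arev) h \<noteq> {}"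
    and "compact (fiber (cobd_adj G) (cubes G arev) h)"
    and "convex (fiber (cobd_adj G) (cubes G arev) h)"
proof -
  obtain \<beta> where \<beta>_Flat: "\<beta> \<in> Flat G \<int>" and h_in_Vor: "h \<in> Vor G (cobd_adj G \<beta>)"
    using assms H0_eq_Union_Vor by blast
  note polytope = polytope_cube[OF Flat_Ints_in_C1[OF \<beta>_Flat]]
  have "h \<in> cobd_adj G ` cube G arev \<beta>" using \<beta>_Flat h_in_Vor cobd_adj_image_cube by blast
  then show "fiber (cobd_adj G) (cubes G arev) h \<noteq> {}"
    unfolding fiber_cubes_eq_fiber_cube[OF \<beta>_Flat h_in_Vor] by blast
  show "compact (fiber (cobd_adj G) (cubes G arev) h)"
    unfolding fiber_cubes_eq_fiber_cube[OF \<beta>_Flat h_in_Vor]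
    by (rule compact_fiber[OF polytope_imp_compact[OF polytope] continuous_on_cobd_adj])
  show "convex (fiber (cobd_adj G) (cubes G arev) h)"
    unfolding fiber_cubes_eq_fiber_cube[OF \<beta>_Flat h_in_Vor]
    by (rule convex_fiber_linear[OF linear_cobd_adj polytope_imp_convex[OF polytope]])
qed

text \<open>A lattice point \<open>\<beta>\<close> closest to \<open>x\<close> has norm at most twice that of \<open>x\<close>, because \<open>0\<close> is a
  lattice point as well.\<close>

lemma finite_Vor_meeting_bounded:
  assumes "bounded B"
  shows "finite {\<beta> \<in> Flat G \<int>. Vor G (cobd_adj G \<beta>) \<inter> B \<noteq> {}}" (is "finite ?S")
proof -
  obtain R where norm_le_R: "\<And>h. h \<in> B \<Longrightarrow> norm h \<le> R" using assms unfolding bounded_iff by blast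
  obtain c where c_pos: "c > 0"
    and norm_bound: "\<And>x. x \<in> Flat G UNIV \<Longrightarrow> c * norm x \<le> norm (cobd_adj G x)"
    using injective_imp_isometric
        [OF closed_subspace[OF subspace_Flat] subspace_Flat, of "cobd_adj G"]
      linear_injective_on_subspace_0[OF linear_cobd_adj subspace_Flat] inj_on_cobd_adj_Flat
      linear_cobd_adj by (metis linear_conv_bounded_linear)
  have "norm \<beta> \<le> 2 * (R / c)" if meets: "\<beta> \<in> ?S" for \<beta>
  proof -
    obtain h where \<beta>_Flat: "\<beta> \<in> Flat G \<int>" and h_in_Vor: "h \<in> Vor G (cobd_adj G \<beta>)"
      and h_in_B: "h \<in> B"
      using meets by blast
    then have "h \<in> H0 G" by (simp add: Vor_def)
    then obtain x where x_Flat: "x \<in> Flat G UNIV" and h_eq: "h = cobd_adj G x"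
      using cobd_adj_image_Flat by blast
    have "norm (x - \<beta>) \<le> norm x"
      using cobd_adj_Flat_mem_Vor_iff[OF x_Flat \<beta>_Flat] h_in_Vor zero_in_Flat_Ints
      by (force simp: h_eq)
    then have "norm \<beta> \<le> 2 * norm x"
      using norm_triangle_ineq2[of \<beta> x] by (simp add: norm_minus_commute)
    also have "c * norm x \<le> R" using norm_bound[OF x_Flat] norm_le_R[OF h_in_B] by (simp add: h_eq)
    then have "norm x \<le> R / c" using c_pos by (simp add: pos_le_divide_eq mult.commute)
    finally show ?thesis by simp
  qed
  then have "bounded ?S" unfolding bounded_iff by blast
  moreover have "uniform_discrete ?S"
    unfolding uniform_discrete_def by (rule exI[of _ 1]) (use Flat_Ints_dist_less_1 in auto)
  ultimately show ?thesis using uniform_discrete_finite_iff by blast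
qed

lemma continuous_on_closest_point_fiber_cubes:
  "continuous_on (H0 G) (\<lambda>h. closest_point (fiber (cobd_adj G) (cubes G arev) h) a)"
proof (rule continuous_on_locally_finite_closed_cover
    [where I = "Flat G \<int>" and T = "\<lambda>\<beta>. Vor G (cobd_adj G \<beta>)"])
  fix h assume "h \<in> H0 G"
  then show "\<exists>V. openin (top_of_set (H0 G)) V \<and> h \<in> V \<and>
      finite {\<beta> \<in> Flat G \<int>. Vor G (cobd_adj G \<beta>) \<inter> V \<noteq> {}}"
    by (intro exI[of _ "H0 G \<inter> ball h 1"] conjI finite_Vor_meeting_bounded openin_open_Int)
      (auto intro: bounded_subset[OF bounded_ball])
next
  fix \<beta> assume \<beta>_Flat: "\<beta> \<in> Flat G \<int>"
  note polytope = polytope_cube[OF Flat_Ints_in_C1[OF \<beta>_Flat]]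
  have "closed (Vor G (cobd_adj G \<beta>))"
    using polytope_imp_closed[OF polytope_linear_image[OF linear_cobd_adj[of G] polytope]]
    unfolding cobd_adj_image_cube[OF \<beta>_Flat] .
  then show "closedin (top_of_set (H0 G)) (Vor G (cobd_adj G \<beta>))"
    by (intro closed_subset) (auto simp: Vor_def)
  have "continuous_on (cobd_adj G ` cube G arev \<beta>)
      (\<lambda>h. closest_point (fiber (cobd_adj G) (cube G arev \<beta>) h) a)"
    by (intro continuous_on_closest_point_fiber polytope_imp_compact polytope continuous_on_cobd_adj
        openin_linear_image_polytope linear_cobd_adj convex_fiber_linear polytope_imp_convex)
  then show "continuous_on (Vor G (cobd_adj G \<beta>))
      (\<lambda>h. closest_point (fiber (cobd_adj G) (cubes G arev) h) a)"
    unfolding cobd_adj_image_cube[OF \<beta>_Flat]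
    by (rule continuous_on_eq) (simp only: fiber_cubes_eq_fiber_cube[OF \<beta>_Flat])
qed (simp add: H0_eq_Union_Vor)

theorem cubes_homotopy_eqv_H0: "cubes G arev homotopy_eqv H0 G"
proof (rule homotopy_eqv_convex_fibers_section[OF continuous_on_cobd_adj _
      continuous_on_closest_point_fiber_cubes])
  let ?s = "\<lambda>h. closest_point (fiber (cobd_adj G) (cubes G arev) h) 0"
  have "?s h \<in> fiber (cobd_adj G) (cubes G arev) h" if "h \<in> H0 G" for h
    using fiber_cubes_nonempty_compact_convex[OF that]
    by (intro closest_point_in_set compact_imp_closed)
  then show "?s ` H0 G \<subseteq> cubes G arev" and "\<And>h. h \<in> H0 G \<Longrightarrow> cobd_adj G (?s h) = h" by auto
  show "cobd_adj G ` cubes G arev \<subseteq> H0 G"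
    using cobd_adj_image_C1 cube_subset_C1 by (fastforce simp: cubes_def)
qed (rule fiber_cubes_nonempty_compact_convex)

theorem contractible_cubes: "contractible (cubes G arev)"
  using homotopy_eqv_contractibility[OF cubes_homotopy_eqv_H0]
    convex_imp_contractible[OF subspace_imp_convex[OF subspace_H0]] by blast

theorem complex_isomorphic_cubes_Vor:
  "complex_isomorphic (Flat G \<int>) (dual_complex (Flat G \<int>) (cube G arev))
    (Lam G \<int>) (dual_complex (Lam G \<int>) (Vor G))"
proof (rule complex_isomorphic_dual_complex[where f = "cobd_adj G"])
  show "bij_betw (cobd_adj G) (Flat G \<int>) (Lam G \<int>)"
    using inj_on_subset[OF inj_on_cobd_adj_Flat Flat_mono[of \<int> UNIV]]
    by (simp add: bij_betw_def Lam_def)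
  fix \<beta> assume \<beta>_Flat: "\<beta> \<in> Flat G \<int>"
  show "cobd_adj G -` Vor G (cobd_adj G \<beta>) \<inter> (\<Union>\<beta>\<in>Flat G \<int>. cube G arev \<beta>) = cube G arev \<beta>"
    using vimage_Vor_Int_cubes[OF \<beta>_Flat] by (simp add: cubes_def)
  show "Vor G (cobd_adj G \<beta>) \<subseteq> cobd_adj G ` (\<Union>\<beta>\<in>Flat G \<int>. cube G arev \<beta>)"
    using cobd_adj_image_cube[OF \<beta>_Flat] \<beta>_Flat by blast
qed

end

theorem theorem3p14:
  fixes G :: "('v::finite, 'e::finite) pre_digraph" and arev :: "'e \<Rightarrow> 'e"
  assumes "bidirected_digraph G arev"
    and "loopfree_digraph G"
    and "Digraph_Component.connected G"
  shows
    "(\<forall>\<beta> \<in> Flat G \<int>.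
        linear (cobd_adj G) \<and>
        cobd_adj G ` cube G arev \<beta> = Vor G (cobd_adj G \<beta>) \<and>
        cobd_adj G ` (top_of_set (C1 G arev UNIV) interior_of cube G arev \<beta>) =
          top_of_set (H0 G) interior_of Vor G (cobd_adj G \<beta>)) \<and>
     (\<forall>\<beta> \<in> Flat G \<int>.
        cobd_adj G -` Vor G (cobd_adj G \<beta>) \<inter> cubes G arev = cube G arev \<beta>) \<and>
     ((\<forall>h \<in> Lam G UNIV.
         {x \<in> cubes G arev. cobd_adj G x = h} \<noteq> {} \<and>
         compact {x \<in> cubes G arev. cobd_adj G x = h} \<and>
         contractible {x \<in> cubes G arev. cobd_adj G x = h}) \<and>
      cubes G arev \<noteq> {} \<and> contractible (cubes G arev)) \<and>
     complex_isomorphic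
       (Flat G \<int>) (dual_complex (Flat G \<int>) (cube G arev))
       (Lam G \<int>) (dual_complex (Lam G \<int>) (Vor G))"
proof -
  interpret connected_bidirected_digraph G arev
    using assms(1,3)
    by (simp add: connected_bidirected_digraph_def connected_bidirected_digraph_axioms_def
        finite_bidirected_digraph_def)
  have Lam_eq_H0: "Lam G UNIV = H0 G" using H0_eq_Lam[OF assms(1,3)] by simp
  have "cubes G arev \<noteq> {}"
    using fiber_cubes_nonempty_compact_convex(1)[OF subspace_0[OF subspace_H0]] by blast
  then show ?thesis
    unfolding Lam_eq_H0
    by (intro conjI ballI linear_cobd_adj cobd_adj_image_cube cobd_adj_image_interior_cube
        vimage_Vor_Int_cubes fiber_cubes_nonempty_compact_convex convex_imp_contractible
        contractible_cubes complex_isomorphic_cubes_Vor)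
qed

end
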